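(* Let $n\ge 1$. For all but finitely many primes $p\nmid n$ and for each positive power $q$ of $p$, let $$\mathcal{F}(q,n)=\{a : a\mid n \text{ and } q\equiv 1 \bmod \tfrac{n}{a}\},$$ where $a$ ranges over positive integers. Then $$|\mathcal{R}_n(\mathbb{F}_q)|=q^{2n-1}\Big(\sum_{a\in\mathcal{F}(q,n)}\phi\big(\tfrac{n}{a}\big)\, q^{a-n}\Big).$$ In particular, for $\gcd(q-1,n)=1$, $$|\mathcal{R}_n(\mathbb{F}_q)|=q^{2n-1},$$ and for $q\equiv 1\bmod n$, $$|\mathcal{R}_n(\mathbb{F}_q)|=q^{2n-1}\Big(\sum_{i=0}^{n-1}\phi\big(\tfrac{n}{n-i}\big)\, q^{-i}\Big).$$ When $n$ is prime and $q\equiv 1\bmod n$, this gives $|\mathcal{R}_n(\mathbb{F}_q)|=q^{2n-1}+(n-1)q^n$.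
   Context: For monic degree $n$ polynomials $\phi(z)=z^n+a_{n-1}z^{n-1}+\cdots+a_0$ and $\psi(z)=z^n+b_{n-1}z^{n-1}+\cdots+b_0$, the resultant $\mathcal{R}(\phi,\psi)$ is the determinant of the $2n\times 2n$ matrix whose first $n$ rows are the successive right shifts of $(a_0,a_1,\dots,a_{n-1},1,0,\dots,0)$ and whose last $n$ rows are the successive right shifts of $(b_0,b_1,\dots,b_{n-1},1,0,\dots,0)$ (equal to $\prod_{\psi(\beta)=0}\phi(\beta)$, roots with multiplicity). $\mathcal{R}_n(\mathbb{F}_q)$ is the set of pairs $(\phi,\psi)$ of monic degree $n$ polynomials over $\mathbb{F}_q$ with $\mathcal{R}(\phi,\psi)=1$. In the point-count formulas, $\phi$ denotes Euler's totient function, extended to be identically $0$ on $\mathbb{Q}\setminus\mathbb{N}$. *)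

theory Defs
  imports
    "HOL-Algebra.Polynomials"
    "HOL-Combinatorics.Permutations"
    "HOL-Number_Theory.Totient"
    "HOL-Number_Theory.Cong"
begin

text \<open>
  Finite fields are handled with the locale-based algebra library, not with the type class
  \<open>field\<close>: a finite type of class \<open>field\<close> has one fixed cardinality, so a statement about all but
  finitely many characteristics would be void for it.  The type of the carrier's elements stays a type variable;
  instantiated with an infinite type such as \<open>nat\<close>, it accommodates all finite fields up to
  isomorphism at once.

  The library's determinant needs a type-class ring, so here is the Leibniz formula over the
  carrier of a ring, for the square matrix \<open>A\<close> with rows and columns \<open>0, \<dots>, m - 1\<close>.
\<close>

definition ring_det :: "('a, 'b) ring_scheme \<Rightarrow> nat \<Rightarrow> (nat \<Rightarrow> nat \<Rightarrow> 'a) \<Rightarrow> 'a" where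
  "ring_det R m A =
     (\<Oplus>\<^bsub>R\<^esub>\<sigma> \<in> {\<sigma>. \<sigma> permutes {0..<m}}.
        (if evenperm \<sigma> then \<one>\<^bsub>R\<^esub> else \<ominus>\<^bsub>R\<^esub> \<one>\<^bsub>R\<^esub>) \<otimes>\<^bsub>R\<^esub> (\<Otimes>\<^bsub>R\<^esub>i \<in> {0..<m}. A i (\<sigma> i)))"

text \<open>
  Coefficients are listed in ascending order along each row: row \<open>i < n\<close> is
  \<open>(a\<^sub>0, \<dots>, a\<^sub>n\<^sub>-\<^sub>1, 1, 0, \<dots>, 0)\<close> shifted right by \<open>i\<close>, and row \<open>n + i\<close> is the same for \<open>g\<close>.
  The trailing zeros come from \<^const>\<open>ring.coeff\<close>, which is zero above the degree.
\<close>

definition resultant_matrix ::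
    "('a, 'b) ring_scheme \<Rightarrow> nat \<Rightarrow> 'a list \<Rightarrow> 'a list \<Rightarrow> nat \<Rightarrow> nat \<Rightarrow> 'a" where
  "resultant_matrix R n f g i j =
     (let shifted_row = (\<lambda>h k. if k \<le> j then ring.coeff R h (j - k) else \<zero>\<^bsub>R\<^esub>)
      in if i < n then shifted_row f i else shifted_row g (i - n))"

definition monic_resultant :: "('a, 'b) ring_scheme \<Rightarrow> nat \<Rightarrow> 'a list \<Rightarrow> 'a list \<Rightarrow> 'a" where
  "monic_resultant R n f g = ring_det R (2 * n) (resultant_matrix R n f g)"

definition monic_polys :: "('a, 'b) ring_scheme \<Rightarrow> nat \<Rightarrow> 'a list set" where
  "monic_polys R n =
     {f \<in> carrier (univ_poly R (carrier R)). f \<noteq> [] \<and> degree f = n \<and> lead_coeff f = \<one>\<^bsub>R\<^esub>}"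

definition resultant_one_pairs :: "('a, 'b) ring_scheme \<Rightarrow> nat \<Rightarrow> ('a list \<times> 'a list) set" where
  "resultant_one_pairs R n =
     {(f, g). f \<in> monic_polys R n \<and> g \<in> monic_polys R n \<and> monic_resultant R n f g = \<one>\<^bsub>R\<^esub>}"

definition totient_ext :: "rat \<Rightarrow> nat" where
  "totient_ext x = (if x \<in> \<nat> then totient (nat \<lfloor>x\<rfloor>) else 0)"

definition F_set :: "nat \<Rightarrow> nat \<Rightarrow> nat set" where
  "F_set q n = {a. a > 0 \<and> a dvd n \<and> [q = 1] (mod (n div a))}"

end

theory Submission
  imports Defs Complex_Main "Jordan_Normal_Form.Determinant"
begin

text \<open>
  The count is by character sums over the cyclic group \<open>F\<^sup>*\<close>, for an arbitrary finite field
  \<open>F\<close> with \<open>q\<close> elements.  Write \<open>R(f, g) = \<Prod> f(\<beta>)\<close>, the product over the roots \<open>\<beta>\<close> of the monic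
  polynomial \<open>g\<close>; this is the sign convention of the ascending Sylvester matrix.  For a
  character \<open>\<chi>\<close> of order \<open>e\<close>, extended by \<open>\<chi>(0) = 0\<close>, put
  \<open>T(n, m) = \<Sum> \<chi>(R(f, g))\<close>, summed over the monic \<open>f\<close> of degree \<open>n\<close> and the monic \<open>g\<close> of degree \<open>m\<close>.

  The sum \<open>T\<close> is computed by the Euclidean algorithm, without any factorization of
  polynomials.  If \<open>0 < m \<le> n\<close>, then \<open>R(f, g)\<close> depends only on the remainder of \<open>f\<close> modulo
  \<open>g\<close>, and every remainder occurs for \<open>q\<^bsup>n-m\<^esup>\<close> polynomials \<open>f\<close>.  A nonzero remainder is \<open>c h\<close> with \<open>h\<close>
  monic of some degree \<open>j < m\<close>, and \<open>R(c h, g) = c\<^sup>m R(h, g)\<close>.  Hence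
  \<open>T(n, m) = q\<^bsup>n-m\<^esup> (\<Sum>\<^sub>c \<chi>(c)\<^sup>m) (\<Sum>\<^bsub>j<m\<^esub> T(j, m))\<close>.  The sum over \<open>c\<close> is \<open>q - 1\<close> if \<open>e\<close> divides \<open>m\<close> and
  \<open>0\<close> otherwise.  In the first case the sign \<open>(-1)\<^bsup>j m\<^esup>\<close> in \<open>R(f, g) = (-1)\<^bsup>j m\<^esup> R(g, f)\<close> is invisible
  to \<open>\<chi>\<close>, so \<open>T(j, m) = T(m, j)\<close> and the recursion closes.  Its solution is
  \<open>T(n, m) = q\<^sup>n (q - 1) q\<^bsup>m/e-1\<^esup>\<close> for \<open>e dvd m\<close> (lemma \<open>res_sum_eq\<close>).

  By orthogonality the number of pairs with \<open>R(f, g) = 1\<close> is the mean of \<open>T(n, n)\<close> over the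
  \<open>q - 1\<close> characters.  Since \<open>\<phi>(e)\<close> of them have order \<open>e\<close>, for each \<open>e\<close> dividing \<open>q - 1\<close>, the count is
  \<open>\<Sum> \<phi>(e) q\<^bsup>n-1+n/e\<^esup>\<close> over the common divisors \<open>e\<close> of \<open>q - 1\<close> and \<open>n\<close>; with \<open>a = n/e\<close> this is
  the asserted formula (theorem \<open>card_resultant_one_pairs\<close>).  Since \<open>F\<close> was an
  arbitrary finite field, the set of exceptional primes can be taken to be empty.

  The rules for \<open>R\<close> used above are determinant identities.  They are proved over a
  commutative ring that is a type, and then carried over to the carrier of \<open>F\<close> by a surjective ring
  homomorphism from \<open>\<int>[x]\<close> to \<open>F\<close>, which exists because \<open>F\<^sup>*\<close> is cyclic.
\<close>

section \<open>Sylvester determinants over a commutative ring\<close>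

text \<open>
  Polynomials are given by their coefficient functions.  The first \<open>m\<close> rows are shifts of
  \<open>f\<close>, the others are shifts of \<open>g\<close>; the zero element \<open>z\<close> is a parameter, so that the same entries serve for
  a ring on a type and for a ring on a carrier.
\<close>

definition sylvester_entry :: "nat \<Rightarrow> (nat \<Rightarrow> 'c) \<Rightarrow> (nat \<Rightarrow> 'c) \<Rightarrow> 'c \<Rightarrow> nat \<Rightarrow> nat \<Rightarrow> 'c" where
  "sylvester_entry m f g z i j =
     (if i < m then (if i \<le> j then f (j - i) else z)
      else (if i - m \<le> j then g (j - (i - m)) else z))"

text \<open>
  The sizes \<open>n\<close> and \<open>m\<close> are nominal degrees, which may exceed the actual ones.  For monic \<open>g\<close> of
  degree \<open>m\<close> the value is the product of \<open>f\<close> over the roots of \<open>g\<close> in a splitting ring, whatever the nominal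
  degree of \<open>f\<close>.
\<close>

definition sylvester_det :: "nat \<Rightarrow> nat \<Rightarrow> (nat \<Rightarrow> 'c::comm_ring_1) \<Rightarrow> (nat \<Rightarrow> 'c) \<Rightarrow> 'c" where
  "sylvester_det n m f g = det (mat (n + m) (n + m) (\<lambda>(i, j). sylvester_entry m f g 0 i j))"

text \<open>
  This is invariance under \<open>f \<mapsto> f + a x\<^sup>k g\<close>: when \<open>k + m \<le> n\<close>, each row of the \<open>f\<close> block
  receives a multiple of a row of the \<open>g\<close> block, so that the matrix is multiplied by a unipotent one.
\<close>

lemma sylvester_det_add_shift:
  fixes f g :: "nat \<Rightarrow> 'c::comm_ring_1"
  assumes "k + m \<le> n"
  shows "sylvester_det n m (\<lambda>i. f i + (if k \<le> i then a * g (i - k) else 0)) g = sylvester_det n m f g"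
proof -
  let ?N = "n + m"
  define S where "S = mat ?N ?N (\<lambda>(i, j). sylvester_entry m f g 0 i j)"
  define S' where "S' = mat ?N ?N (\<lambda>(i, j). sylvester_entry m
      (\<lambda>i. f i + (if k \<le> i then a * g (i - k) else 0)) g 0 i j)"
  define C where "C = mat ?N ?N (\<lambda>(i, l). (if l = i then 1 else 0) +
      (if i < m \<and> l = m + (i + k) then a else 0))"
  have carr: "S \<in> carrier_mat ?N ?N" "S' \<in> carrier_mat ?N ?N" "C \<in> carrier_mat ?N ?N"
    by (auto simp: S_def S'_def C_def)
  have "det C = prod_list (diag_mat C)"
    by (rule det_upper_triangular[OF _ carr(3)]) (auto simp: C_def upper_triangular_def)
  also have "diag_mat C = replicate ?N 1"
    by (auto simp: diag_mat_def C_def intro!: nth_equalityI)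
  finally have detC: "det C = 1" by simp
  have "S' = C * S"
  proof (rule eq_matI)
    fix i j assume "i < dim_row (C * S)" "j < dim_col (C * S)"
    hence i: "i < ?N" and j: "j < ?N" using carr by auto
    have "(C * S) $$ (i, j) = (\<Sum>l\<in>{0..<?N}. C $$ (i, l) * S $$ (l, j))"
      using i j carr by (simp add: scalar_prod_def)
    also have "\<dots> = (\<Sum>l\<in>{0..<?N}. (if l = i then S $$ (i, j) else 0) +
        (if l = m + (i + k) then (if i < m then a * S $$ (m + (i + k), j) else 0) else 0))"
      by (rule sum.cong) (use i in \<open>auto simp: C_def algebra_simps\<close>)
    also have "\<dots> = S $$ (i, j) +
        (if m + (i + k) < ?N then (if i < m then a * S $$ (m + (i + k), j) else 0) else 0)"
      using i by (simp add: sum.distrib)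
    also have "\<dots> = S' $$ (i, j)"
      using i j assms
      by (auto simp: S_def S'_def sylvester_entry_def)
    finally show "S' $$ (i, j) = (C * S) $$ (i, j)" by simp
  qed (use carr in auto)
  hence "det S' = det S"
    using det_mult[OF carr(3) carr(1)] detC by simp
  thus ?thesis by (simp add: sylvester_det_def S_def S'_def)
qed

text \<open>
  The last column has its only nonzero entry, the leading coefficient \<open>1\<close> of \<open>g\<close>, in the
  last row; expansion along this column gives cofactor sign \<open>+1\<close>.
\<close>

lemma sylvester_det_drop_degree:
  fixes f g :: "nat \<Rightarrow> 'c::comm_ring_1"
  assumes f: "\<And>i. i > n \<Longrightarrow> f i = 0" and g: "g m = 1" "\<And>i. i > m \<Longrightarrow> g i = 0"
  shows "sylvester_det (Suc n) m f g = sylvester_det n m f g"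
proof -
  let ?N = "Suc (n + m)"
  define S where "S = mat ?N ?N (\<lambda>(i, j). sylvester_entry m f g 0 i j)"
  have carr: "S \<in> carrier_mat ?N ?N" by (simp add: S_def)
  have last_col: "S $$ (i, n + m) = (if i = n + m then 1 else 0)" if "i < ?N" for i
    using that f g by (auto simp: S_def sylvester_entry_def)
  have "det S = (\<Sum>i<?N. S $$ (i, n + m) * cofactor S i (n + m))"
    by (rule laplace_expansion_column[OF carr]) simp
  also have "\<dots> = (\<Sum>i<?N. if i = n + m then cofactor S (n + m) (n + m) else 0)"
    by (rule sum.cong) (auto simp: last_col)
  also have "\<dots> = det (mat_delete S (n + m) (n + m))"
    by (simp add: cofactor_def flip: mult_2)
  also have "mat_delete S (n + m) (n + m) = mat (n + m) (n + m) (\<lambda>(i, j). sylvester_entry m f g 0 i j)"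
    by (rule eq_matI) (auto simp: mat_delete_def S_def)
  finally show ?thesis by (simp add: sylvester_det_def S_def)
qed

lemma sylvester_det_scale:
  fixes f g :: "nat \<Rightarrow> 'c::comm_ring_1"
  shows "sylvester_det n m (\<lambda>i. c * f i) g = c ^ m * sylvester_det n m f g"
proof -
  let ?N = "n + m"
  have scale: "(\<Prod>i = 0..<?N. sylvester_entry m (\<lambda>i. c * f i) g 0 i (p i)) =
     c ^ m * (\<Prod>i = 0..<?N. sylvester_entry m f g 0 i (p i))" for p :: "nat \<Rightarrow> nat"
  proof -
    have "(\<Prod>i = 0..<?N. sylvester_entry m (\<lambda>i. c * f i) g 0 i (p i)) =
       (\<Prod>i = 0..<?N. (if i < m then c else 1) * sylvester_entry m f g 0 i (p i))"
      by (rule prod.cong) (auto simp: sylvester_entry_def)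
    also have "\<dots> = (\<Prod>i = 0..<?N. if i < m then c else 1) *
       (\<Prod>i = 0..<?N. sylvester_entry m f g 0 i (p i))"
      by (rule prod.distrib)
    also have "(\<Prod>i = 0..<?N. if i < m then c else 1) = c ^ card ({0..<?N} \<inter> {i. i < m})"
      by (simp add: prod.If_cases)
    also have "{0..<?N} \<inter> {i. i < m} = {0..<m}" by auto
    finally show ?thesis by simp
  qed
  have entry: "(\<Prod>i = 0..<?N. mat ?N ?N (\<lambda>(i, j). h i j) $$ (i, p i)) = (\<Prod>i = 0..<?N. h i (p i))"
    if "p permutes {0..<?N}" for p and h :: "nat \<Rightarrow> nat \<Rightarrow> 'c"
    by (rule prod.cong) (use permutes_in_image[OF that] in auto)
  show ?thesis
    unfolding sylvester_det_def det_def
    by (simp add: sum_distrib_left, intro sum.cong refl)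
       (simp only: mem_Collect_eq entry scale mult_ac)
qed

lemma sylvester_det_swap:
  fixes f g :: "nat \<Rightarrow> 'c::comm_ring_1"
  shows "sylvester_det n m f g = (-1) ^ (n * m) * sylvester_det m n g f"
proof -
  let ?A = "mat (n + m) (n + m) (\<lambda>(i, j). sylvester_entry m f g 0 i j)"
  have "det ?A = (-1) ^ (n * m) *
      det (mat (n + m) (n + m) (\<lambda>(i, j). ?A $$ (if i < n then i + m else i - n, j)))"
    by (rule det_swap_rows) simp
  also have "mat (n + m) (n + m) (\<lambda>(i, j). ?A $$ (if i < n then i + m else i - n, j)) =
      mat (m + n) (m + n) (\<lambda>(i, j). sylvester_entry n g f 0 i j)"
    by (rule eq_matI) (auto simp: sylvester_entry_def)
  finally show ?thesis by (simp add: sylvester_det_def)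
qed

lemma sylvester_det_one_right:
  fixes f g :: "nat \<Rightarrow> 'c::comm_ring_1"
  assumes "g 0 = 1" "\<And>i. i > 0 \<Longrightarrow> g i = 0"
  shows "sylvester_det n 0 f g = 1"
proof -
  have "mat n n (\<lambda>(i, j). sylvester_entry 0 f g 0 i j) = 1\<^sub>m n"
    using assms by (intro eq_matI) (auto simp: sylvester_entry_def)
  thus ?thesis by (simp add: sylvester_det_def)
qed

section \<open>Transfer of determinants along a ring homomorphism\<close>

text \<open>
  Determinant identities over the type pass to \<open>R\<close> along \<open>ev\<close>.
\<close>

locale comm_ring_eval = cring R for R (structure) +
  fixes ev :: "'c::comm_ring_1 \<Rightarrow> 'a"
  assumes ev_closed [simp, intro]: "ev u \<in> carrier R"
    and ev_add: "ev (u + v) = ev u \<oplus> ev v"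
    and ev_mult: "ev (u * v) = ev u \<otimes> ev v"
    and ev_one: "ev 1 = \<one>"
begin

lemma ev_zero: "ev 0 = \<zero>"
  using ev_add[of 0 0, symmetric] by simp

lemma ev_minus: "ev (- u) = \<ominus> ev u"
  using ev_add[of "- u" u] by (simp add: ev_zero minus_equality)

lemma ev_sum: "finite A \<Longrightarrow> ev (sum h A) = (\<Oplus>x\<in>A. ev (h x))"
  by (induction A rule: finite_induct) (auto simp: ev_zero ev_add)

lemma ev_prod: "finite A \<Longrightarrow> ev (prod h A) = (\<Otimes>x\<in>A. ev (h x))"
  by (induction A rule: finite_induct) (auto simp: ev_one ev_mult)

lemma ev_power: "ev (u ^ k) = ev u [^] k"
  by (induction k) (auto simp: ev_one ev_mult m_comm)

lemma ev_det: "ev (det (mat N N (\<lambda>(i, j). h i j))) = ring_det R N (\<lambda>i j. ev (h i j))"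
proof -
  have sgn: "ev (of_int (sign \<sigma>)) = (if evenperm \<sigma> then \<one> else \<ominus> \<one>)" for \<sigma> :: "nat \<Rightarrow> nat"
    by (auto simp: sign_def ev_one ev_minus)
  have "ev (det (mat N N (\<lambda>(i, j). h i j))) =
      ev (\<Sum>\<sigma>\<in>{\<sigma>. \<sigma> permutes {0..<N}}. of_int (sign \<sigma>) * (\<Prod>i = 0..<N. h i (\<sigma> i)))"
    unfolding det_def'[OF mat_carrier]
    by (intro arg_cong[of _ _ ev] sum.cong refl arg_cong2[of _ _ _ _ "(*)"] prod.cong)
       (auto dest: permutes_in_image)
  also have "\<dots> = ring_det R N (\<lambda>i j. ev (h i j))"
    by (simp add: ring_det_def ev_sum ev_prod ev_mult sgn finite_permutations)
  finally show ?thesis .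
qed

end

text \<open>
  Evaluation of an integer polynomial by Horner's rule.
\<close>

definition (in cring) eval_int_poly :: "'a \<Rightarrow> int poly \<Rightarrow> 'a" where
  "eval_int_poly x p = fold_coeffs (\<lambda>a y. [a] \<cdot> \<one> \<oplus> x \<otimes> y) p \<zero>"

context cring
begin

lemma eval_int_poly_0 [simp]: "eval_int_poly x 0 = \<zero>"
  by (simp add: eval_int_poly_def)

lemma int_add_pow_0 [simp]: "[(0::int)] \<cdot> y = \<zero>"
  by (simp add: add_pow_def int_pow_def)

lemma eval_int_poly_pCons:
  assumes "x \<in> carrier R"
  shows "eval_int_poly x (pCons a p) = [a] \<cdot> \<one> \<oplus> x \<otimes> eval_int_poly x p"
  using assms by (cases "p = 0 \<and> a = 0") (auto simp: eval_int_poly_def)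

lemma eval_int_poly_closed [simp]:
  assumes "x \<in> carrier R"
  shows "eval_int_poly x p \<in> carrier R"
  by (induction p) (use assms in \<open>auto simp: eval_int_poly_pCons\<close>)

lemma eval_int_poly_add:
  assumes x: "x \<in> carrier R"
  shows "eval_int_poly x (p + q) = eval_int_poly x p \<oplus> eval_int_poly x q"
proof (induction p q rule: poly_induct2)
  case (pCons a p b q)
  have "([a] \<cdot> \<one> \<oplus> [b] \<cdot> \<one>) \<oplus> x \<otimes> (s \<oplus> t) = ([a] \<cdot> \<one> \<oplus> x \<otimes> s) \<oplus> ([b] \<cdot> \<one> \<oplus> x \<otimes> t)"
    if "s \<in> carrier R" "t \<in> carrier R" for s t
    using x that by (simp add: r_distr add.m_ac)
  thus ?case
    using x by (simp add: eval_int_poly_pCons pCons.IH add.int_pow_mult)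
qed simp

lemma int_add_pow_mult: "[(a * b :: int)] \<cdot> \<one> = ([a] \<cdot> \<one>) \<otimes> ([b] \<cdot> \<one>)"
  by (simp add: add_pow_ldistr_int add.int_pow_pow mult.commute)

lemma eval_int_poly_smult:
  assumes x: "x \<in> carrier R"
  shows "eval_int_poly x (smult c p) = [c] \<cdot> \<one> \<otimes> eval_int_poly x p"
proof (induction p)
  case (pCons a p)
  have "([c] \<cdot> \<one>) \<otimes> ([a] \<cdot> \<one>) \<oplus> x \<otimes> (([c] \<cdot> \<one>) \<otimes> s) = ([c] \<cdot> \<one>) \<otimes> ([a] \<cdot> \<one> \<oplus> x \<otimes> s)"
    if "s \<in> carrier R" for s
    using x that by (simp add: r_distr m_lcomm)
  thus ?case
    using x by (simp add: eval_int_poly_pCons pCons.IH int_add_pow_mult)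
qed simp

lemma eval_int_poly_mult:
  assumes x: "x \<in> carrier R"
  shows "eval_int_poly x (p * q) = eval_int_poly x p \<otimes> eval_int_poly x q"
proof (induction p)
  case (pCons a p)
  show ?case
    using x by (simp add: eval_int_poly_pCons eval_int_poly_add eval_int_poly_smult pCons.IH
        l_distr m_assoc)
qed (use x in simp)

lemma eval_int_poly_1 [simp]: "x \<in> carrier R \<Longrightarrow> eval_int_poly x 1 = \<one>"
  by (simp add: one_pCons eval_int_poly_pCons add_pow_def int_pow_def)

lemma comm_ring_eval_int_poly:
  assumes "x \<in> carrier R"
  shows "comm_ring_eval R (eval_int_poly x)"
  by unfold_locales (use assms in \<open>auto simp: eval_int_poly_add eval_int_poly_mult\<close>)

end

section \<open>Resultants over a finite field\<close>

locale finite_field_carrier = field F for F (structure) +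
  assumes finite_carrier: "finite (carrier F)"
begin

definition q :: nat where "q = card (carrier F)"

definition gen :: 'a where
  "gen = (SOME w. w \<in> carrier F - {\<zero>} \<and> carrier F - {\<zero>} = range (\<lambda>t::nat. w [^] t))"

lemma gen: "gen \<in> carrier F - {\<zero>}" "carrier F - {\<zero>} = range (\<lambda>t::nat. gen [^] t)"
proof -
  have "\<exists>w. w \<in> carrier F - {\<zero>} \<and> carrier F - {\<zero>} = range (\<lambda>t::nat. w [^] t)"
    using finite_field_mult_group_has_gen[OF finite_carrier]
    by (auto simp: full_SetCompr_eq)
  from someI_ex[OF this] show "gen \<in> carrier F - {\<zero>}"
    "carrier F - {\<zero>} = range (\<lambda>t::nat. gen [^] t)"
    unfolding gen_def by blast+
qed

definition ev :: "int poly \<Rightarrow> 'a" where "ev = eval_int_poly gen"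

sublocale comm_ring_eval F ev
  unfolding ev_def by (rule comm_ring_eval_int_poly) (use gen in auto)

text \<open>
  Every nonzero element is a power \<open>gen\<^sup>t\<close>, the image of the monomial \<open>x\<^sup>t\<close>.
\<close>

lemma ev_surj:
  assumes "z \<in> carrier F"
  shows "\<exists>u. ev u = z"
proof (cases "z = \<zero>")
  case True
  thus ?thesis using ev_zero by blast
next
  case False
  then obtain t :: nat where t: "z = gen [^] t" using assms gen(2) by blast
  have "ev [:0, 1:] = gen"
    using gen(1) by (simp add: ev_def eval_int_poly_pCons add_pow_def int_pow_def)
  hence "ev ([:0, 1:] ^ t) = z" unfolding t by (simp only: ev_power)
  thus ?thesis by blast
qed

text \<open>
  A section of \<^term>\<open>ev\<close>.  It is not additive, but it has to fix \<open>0\<close> and \<open>1\<close>, so that the lift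
  of a monic polynomial is monic of the same degree.
\<close>

definition lift :: "'a \<Rightarrow> int poly" where
  "lift x = (if x = \<zero> then 0 else if x = \<one> then 1 else SOME u. ev u = x)"

lemma lift_0 [simp]: "lift \<zero> = 0" and lift_1 [simp]: "lift \<one> = 1"
  by (simp_all add: lift_def)

lemma ev_lift [simp]: "x \<in> carrier F \<Longrightarrow> ev (lift x) = x"
  using someI_ex[OF ev_surj[of x]] by (auto simp: lift_def ev_zero ev_one)

text \<open>
  The nominal degrees are \<open>n\<close> for \<open>f\<close> and \<open>m\<close> for \<open>g\<close>.
\<close>

definition res :: "nat \<Rightarrow> nat \<Rightarrow> (nat \<Rightarrow> 'a) \<Rightarrow> (nat \<Rightarrow> 'a) \<Rightarrow> 'a" where
  "res n m f g = ring_det F (n + m) (sylvester_entry m f g \<zero>)"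

text \<open>
  The bridge for the lemmas below: each identity between resultants over \<open>F\<close> is the image of the
  corresponding identity for lifts to \<open>\<int>[x]\<close>.
\<close>

lemma res_ev: "res n m (\<lambda>i. ev (f i)) (\<lambda>i. ev (g i)) = ev (sylvester_det n m f g)"
proof -
  have "ev (sylvester_entry m f g 0 i j) = sylvester_entry m (\<lambda>i. ev (f i)) (\<lambda>i. ev (g i)) \<zero> i j"
    for i j by (auto simp: sylvester_entry_def ev_zero)
  thus ?thesis by (simp add: res_def sylvester_det_def ev_det)
qed

lemma res_eq_ev:
  assumes "\<And>i. f i \<in> carrier F" "\<And>i. g i \<in> carrier F"
  shows "res n m f g = ev (sylvester_det n m (\<lambda>i. lift (f i)) (\<lambda>i. lift (g i)))"
  using res_ev[of n m "\<lambda>i. lift (f i)" "\<lambda>i. lift (g i)"] assms by simp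

lemma res_closed:
  assumes "\<And>i. f i \<in> carrier F" "\<And>i. g i \<in> carrier F"
  shows "res n m f g \<in> carrier F"
  using assms by (simp add: res_eq_ev)

lemma res_add_shift:
  assumes "k + m \<le> n" "a \<in> carrier F" and fg: "\<And>i. f i \<in> carrier F" "\<And>i. g i \<in> carrier F"
  shows "res n m (\<lambda>i. f i \<oplus> (if k \<le> i then a \<otimes> g (i - k) else \<zero>)) g = res n m f g"
proof -
  let ?f = "\<lambda>i. lift (f i)" and ?g = "\<lambda>i. lift (g i)"
  have "res n m (\<lambda>i. f i \<oplus> (if k \<le> i then a \<otimes> g (i - k) else \<zero>)) g =
      res n m (\<lambda>i. ev (?f i + (if k \<le> i then lift a * ?g (i - k) else 0))) (\<lambda>i. ev (?g i))"
    by (intro arg_cong2[of _ _ _ _ "res n m"] ext) (use assms in \<open>auto simp: ev_add ev_mult ev_zero\<close>)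
  also have "\<dots> = ev (sylvester_det n m ?f ?g)"
    by (simp only: res_ev sylvester_det_add_shift[OF assms(1), of ?f "lift a" ?g])
  finally show ?thesis using fg by (simp add: res_eq_ev)
qed

lemma res_drop_degree:
  assumes fg: "\<And>i. f i \<in> carrier F" "\<And>i. g i \<in> carrier F"
    and "\<And>i. i > n \<Longrightarrow> f i = \<zero>" "g m = \<one>" "\<And>i. i > m \<Longrightarrow> g i = \<zero>"
  shows "res (Suc n) m f g = res n m f g"
  using assms by (simp add: res_eq_ev sylvester_det_drop_degree)

lemma res_scale:
  assumes "c \<in> carrier F" and fg: "\<And>i. f i \<in> carrier F" "\<And>i. g i \<in> carrier F"
  shows "res n m (\<lambda>i. c \<otimes> f i) g = c [^] m \<otimes> res n m f g"
proof -
  let ?f = "\<lambda>i. lift (f i)" and ?g = "\<lambda>i. lift (g i)"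
  have "res n m (\<lambda>i. c \<otimes> f i) g = res n m (\<lambda>i. ev (lift c * ?f i)) (\<lambda>i. ev (?g i))"
    by (intro arg_cong2[of _ _ _ _ "res n m"] ext) (use assms in \<open>auto simp: ev_mult\<close>)
  also have "\<dots> = ev (lift c ^ m * sylvester_det n m ?f ?g)"
    by (simp only: res_ev sylvester_det_scale[of n m "lift c" ?f ?g])
  also have "\<dots> = c [^] m \<otimes> ev (sylvester_det n m ?f ?g)"
    using assms(1) by (simp add: ev_mult ev_power)
  finally show ?thesis using fg by (simp add: res_eq_ev)
qed

lemma res_swap:
  assumes fg: "\<And>i. f i \<in> carrier F" "\<And>i. g i \<in> carrier F"
  shows "res n m f g = (\<ominus> \<one>) [^] (n * m) \<otimes> res m n g f"
  unfolding res_eq_ev[OF fg] res_eq_ev[OF fg(2) fg(1)]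
  by (subst sylvester_det_swap) (simp only: ev_mult ev_power ev_minus ev_one)

lemma res_one_right:
  assumes fg: "\<And>i. f i \<in> carrier F" "\<And>i. g i \<in> carrier F"
    and "g 0 = \<one>" "\<And>i. i > 0 \<Longrightarrow> g i = \<zero>"
  shows "res n 0 f g = \<one>"
  using assms by (simp add: res_eq_ev sylvester_det_one_right ev_one)

section \<open>Monic polynomials and division with remainder\<close>

definition deg_less :: "nat \<Rightarrow> (nat \<Rightarrow> 'a) set" where
  "deg_less n = {f. (\<forall>i. f i \<in> carrier F) \<and> (\<forall>i\<ge>n. f i = \<zero>)}"

definition monic :: "nat \<Rightarrow> (nat \<Rightarrow> 'a) set" where
  "monic n = {f \<in> deg_less (Suc n). f n = \<one>}"

lemma deg_less_0: "deg_less 0 = {\<lambda>_. \<zero>}"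
  by (auto simp: deg_less_def)

lemma deg_less_Suc_split: "deg_less (Suc k) = deg_less k \<union> {h \<in> deg_less (Suc k). h k \<noteq> \<zero>}"
  by (auto simp: deg_less_def le_Suc_eq) (metis Suc_leI le_neq_implies_less)

text \<open>
  This is \<open>f + a x\<^sup>s g\<close>.
\<close>

definition add_shift :: "nat \<Rightarrow> (nat \<Rightarrow> 'a) \<Rightarrow> 'a \<Rightarrow> (nat \<Rightarrow> 'a) \<Rightarrow> nat \<Rightarrow> 'a" where
  "add_shift s g a f = (\<lambda>i. f i \<oplus> (if s \<le> i then a \<otimes> g (i - s) else \<zero>))"

lemma add_shift_cancel:
  assumes "a \<in> carrier F" "\<And>i. f i \<in> carrier F" "\<And>i. g i \<in> carrier F"
  shows "add_shift s g a (add_shift s g (\<ominus> a) f) = f" "add_shift s g (\<ominus> a) (add_shift s g a f) = f"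
  using assms by (auto simp: add_shift_def fun_eq_iff a_assoc l_minus r_neg l_neg)

text \<open>
  One step of division by \<open>g\<close>: subtraction of \<open>a x\<^bsup>k-m\<^esup> g\<close> cancels the term \<open>a x\<^sup>k\<close>.  For
  \<open>a = 1\<close> the target is the set of monic polynomials of degree \<open>k\<close>.
\<close>

lemma bij_betw_add_shift:
  assumes "m \<le> k" and g: "g \<in> monic m" and a: "a \<in> carrier F"
  shows "bij_betw (add_shift (k - m) g a) (deg_less k) {h \<in> deg_less (Suc k). h k = a}"
proof (rule bij_betw_byWitness[where f' = "add_shift (k - m) g (\<ominus> a)"])
  have g': "\<And>i. g i \<in> carrier F" "g m = \<one>" "\<And>i. i > m \<Longrightarrow> g i = \<zero>"
    using g by (auto simp: monic_def deg_less_def)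
  show "\<forall>f\<in>deg_less k. add_shift (k - m) g (\<ominus> a) (add_shift (k - m) g a f) = f"
    using a g' by (auto simp: add_shift_cancel deg_less_def)
  show "\<forall>h\<in>{h \<in> deg_less (Suc k). h k = a}. add_shift (k - m) g a (add_shift (k - m) g (\<ominus> a) h) = h"
    using a g' by (auto simp: add_shift_cancel deg_less_def)
  show "add_shift (k - m) g a ` deg_less k \<subseteq> {h \<in> deg_less (Suc k). h k = a}"
    using a g' assms(1) by (auto simp: add_shift_def deg_less_def)
  show "add_shift (k - m) g (\<ominus> a) ` {h \<in> deg_less (Suc k). h k = a} \<subseteq> deg_less k"
  proof (clarsimp simp: deg_less_def, intro conjI allI impI)
    fix h i assume h: "\<forall>i. h i \<in> carrier F" "\<forall>i\<ge>Suc k. h i = \<zero>" "a = h k"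
    show "add_shift (k - m) g (\<ominus> h k) h i \<in> carrier F"
      using h g' by (auto simp: add_shift_def)
    assume "k \<le> i"
    show "add_shift (k - m) g (\<ominus> h k) h i = \<zero>"
    proof (cases "i = k")
      case True
      thus ?thesis using h g' assms(1) by (simp add: add_shift_def r_neg)
    next
      case False
      thus ?thesis using h g' assms(1) \<open>k \<le> i\<close> by (simp add: add_shift_def)
    qed
  qed
qed

lemma bij_betw_scale_monic:
  "bij_betw (\<lambda>(c, f) i. c \<otimes> f i) ((carrier F - {\<zero>}) \<times> monic k) {h \<in> deg_less (Suc k). h k \<noteq> \<zero>}"
proof (rule bij_betw_byWitness[where f' = "\<lambda>h. (h k, \<lambda>i. inv (h k) \<otimes> h i)"])
  have inv_closed': "inv x \<in> carrier F" if "x \<in> carrier F" "x \<noteq> \<zero>" for x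
    using that by (simp add: field_Units)
  have cancel: "inv x \<otimes> (x \<otimes> y) = y" "x \<otimes> (inv x \<otimes> y) = y"
    if "x \<in> carrier F" "x \<noteq> \<zero>" "y \<in> carrier F" for x y
    using that by (simp_all add: field_Units flip: m_assoc)
  have inv_l: "inv x \<otimes> x = \<one>" if "x \<in> carrier F" "x \<noteq> \<zero>" for x
    using that by (simp add: field_Units)
  show "\<forall>p\<in>(carrier F - {\<zero>}) \<times> monic k.
     ((case p of (c, f) \<Rightarrow> \<lambda>i. c \<otimes> f i) k, \<lambda>i. inv ((case p of (c, f) \<Rightarrow> \<lambda>i. c \<otimes> f i) k) \<otimes>
        (case p of (c, f) \<Rightarrow> \<lambda>i. c \<otimes> f i) i) = p"
    by (auto simp: monic_def deg_less_def cancel)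
  show "\<forall>h\<in>{h \<in> deg_less (Suc k). h k \<noteq> \<zero>}. (case (h k, \<lambda>i. inv (h k) \<otimes> h i) of (c, f) \<Rightarrow> \<lambda>i. c \<otimes> f i) = h"
    by (auto simp: deg_less_def cancel)
  show "(\<lambda>(c, f) i. c \<otimes> f i) ` ((carrier F - {\<zero>}) \<times> monic k) \<subseteq> {h \<in> deg_less (Suc k). h k \<noteq> \<zero>}"
    by (auto simp: deg_less_def monic_def)
  show "(\<lambda>h. (h k, \<lambda>i. inv (h k) \<otimes> h i)) ` {h \<in> deg_less (Suc k). h k \<noteq> \<zero>} \<subseteq> (carrier F - {\<zero>}) \<times> monic k"
    by (auto simp: deg_less_def monic_def inv_l inv_closed')
qed

lemma bij_betw_deg_less_Suc:
  "bij_betw (\<lambda>(a, f). f(k := a)) (carrier F \<times> deg_less k) (deg_less (Suc k))"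
  by (rule bij_betw_byWitness[where f' = "\<lambda>h. (h k, h(k := \<zero>))"])
     (auto simp: deg_less_def fun_eq_iff)

lemma finite_deg_less: "finite (deg_less n)" and card_deg_less: "card (deg_less n) = q ^ n"
proof (induction n)
  case (Suc k)
  { case 1 show ?case using bij_betw_finite[OF bij_betw_deg_less_Suc] Suc finite_carrier by auto }
  { case 2 show ?case using bij_betw_same_card[OF bij_betw_deg_less_Suc, of k] Suc
      by (simp add: card_cartesian_product q_def flip: power_Suc) }
qed (simp_all add: deg_less_0)

lemma finite_monic: "finite (monic n)"
  using finite_deg_less by (simp add: monic_def)

lemma monic_0: "monic 0 = {\<lambda>i. if i = 0 then \<one> else \<zero>}"
  by (auto simp: monic_def deg_less_def fun_eq_iff)

text \<open>
  The shift by \<open>x\<^sup>n\<close>, a multiple of the constant \<open>1\<close>, turns polynomials of degree less than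
  \<open>n\<close> into monic ones.
\<close>

lemma card_monic: "card (monic n) = q ^ n"
  using bij_betw_same_card[OF bij_betw_add_shift[of 0 n "\<lambda>i. if i = 0 then \<one> else \<zero>" \<one>]]
  by (simp add: card_deg_less monic_0) (simp add: monic_def)

lemma monicD:
  assumes "f \<in> monic n"
  shows "f i \<in> carrier F" "f n = \<one>" "i > n \<Longrightarrow> f i = \<zero>"
  using assms by (auto simp: monic_def deg_less_def)

lemma deg_lessD:
  assumes "f \<in> deg_less n"
  shows "f i \<in> carrier F" "i \<ge> n \<Longrightarrow> f i = \<zero>"
  using assms by (auto simp: deg_less_def)

end

section \<open>Character sums of resultants\<close>

lemma sum_multiples:
  fixes h :: "nat \<Rightarrow> 'b::comm_monoid_add"
  assumes "d > 0"
  shows "(\<Sum>j<d * i. if d dvd j then h (j div d) else 0) = (\<Sum>k<i. h k)"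
proof (induction i)
  case (Suc i)
  have "(\<Sum>j<d * Suc i. if d dvd j then h (j div d) else 0) =
     (\<Sum>j<d * i. if d dvd j then h (j div d) else 0) +
     (\<Sum>j\<in>{d * i..<d * Suc i}. if d dvd j then h (j div d) else 0)"
    by (subst sum.union_disjoint[symmetric]) (auto intro!: sum.cong)
  also have "(\<Sum>j\<in>{d * i..<d * Suc i}. if d dvd j then h (j div d) else 0) =
     (\<Sum>j\<in>{d * i}. if d dvd j then h (j div d) else 0)"
  proof (rule sum.mono_neutral_right)
    show "\<forall>j\<in>{d * i..<d * Suc i} - {d * i}. (if d dvd j then h (j div d) else 0) = 0"
    proof
      fix j assume "j \<in> {d * i..<d * Suc i} - {d * i}"
      hence "d * i < j" "j < d * Suc i" by auto
      hence "\<not> d dvd j" using assms by (auto simp: mult_less_cancel1 simp del: mult_Suc_right)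
      thus "(if d dvd j then h (j div d) else 0) = 0" by simp
    qed
  qed (use assms in auto)
  finally show ?case using assms Suc.IH by simp
qed simp

text \<open>
  A multiplicative character of exact order \<open>e\<close>, extended by zero.
\<close>

locale finite_field_character = finite_field_carrier F for F (structure) +
  fixes \<chi> :: "'a \<Rightarrow> complex" and e :: nat
  assumes chi_mult: "\<And>x y. x \<in> carrier F \<Longrightarrow> y \<in> carrier F \<Longrightarrow> \<chi> (x \<otimes> y) = \<chi> x * \<chi> y"
    and chi_zero: "\<chi> \<zero> = 0" and chi_one: "\<chi> \<one> = 1"
    and chi_order: "\<And>m. (\<forall>c\<in>carrier F - {\<zero>}. \<chi> c ^ m = 1) \<longleftrightarrow> e dvd m"
    and e_pos: "e > 0"
begin

lemma chi_power: "x \<in> carrier F \<Longrightarrow> \<chi> (x [^] (m::nat)) = \<chi> x ^ m"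
  by (induction m) (simp_all add: chi_one chi_mult mult.commute)

text \<open>
  If \<open>\<chi>(b)\<^sup>m \<noteq> 1\<close> for some \<open>b\<close>, the substitution \<open>c \<mapsto> b c\<close> multiplies the sum by
  \<open>\<chi>(b)\<^sup>m\<close> and so forces it to vanish.
\<close>

lemma sum_chi_power:
  "(\<Sum>c\<in>carrier F - {\<zero>}. \<chi> c ^ m) = (if e dvd m then of_nat q - 1 else 0)"
proof (cases "e dvd m")
  case True
  hence "(\<Sum>c\<in>carrier F - {\<zero>}. \<chi> c ^ m) = (\<Sum>c\<in>carrier F - {\<zero>}. 1)"
    using chi_order[of m] by (intro sum.cong) auto
  also have "\<dots> = of_nat q - 1"
    using finite_carrier by (simp add: card_Diff_subset q_def of_nat_diff card_gt_0_iff Suc_leI)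
      (metis One_nat_def card_gt_0_iff empty_iff less_eq_Suc_le of_nat_1 of_nat_diff zero_closed)
  finally show ?thesis using True by simp
next
  case False
  then obtain b where b: "b \<in> carrier F" "b \<noteq> \<zero>" "\<chi> b ^ m \<noteq> 1"
    using chi_order[of m] by auto
  have inv_b: "inv b \<in> carrier F" "inv b \<noteq> \<zero>" "b \<otimes> inv b = \<one>" "inv b \<otimes> b = \<one>"
    using b by (auto simp: field_Units Units_inv_closed) (metis Units_inv_Units field_Units DiffE DiffI b(1,2) empty_iff insert_iff)
  have "(\<Sum>c\<in>carrier F - {\<zero>}. \<chi> c ^ m) = (\<Sum>c\<in>carrier F - {\<zero>}. \<chi> (b \<otimes> c) ^ m)"
    by (rule sum.reindex_bij_witness[where i = "\<lambda>c. b \<otimes> c" and j = "\<lambda>c. inv b \<otimes> c"])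
       (use b inv_b in \<open>auto simp: integral_iff simp flip: m_assoc\<close>)
  also have "\<dots> = \<chi> b ^ m * (\<Sum>c\<in>carrier F - {\<zero>}. \<chi> c ^ m)"
    using b by (simp add: chi_mult power_mult_distrib sum_distrib_left)
  finally show ?thesis using b False by simp
qed

definition res_sum :: "nat \<Rightarrow> nat \<Rightarrow> complex" where
  "res_sum n m = (\<Sum>g\<in>monic m. \<Sum>f\<in>monic n. \<chi> (res n m f g))"

text \<open>
  Each nonzero \<open>f\<close> is \<open>c h\<close> with \<open>h\<close> monic, and its resultant is \<open>c\<^sup>m R(h, g)\<close>.  The zero
  polynomial contributes \<open>\<chi>(0) = 0\<close>, because \<open>m > 0\<close>.
\<close>

lemma sum_deg_less_eq_sum_monic:
  assumes g: "g \<in> monic m" and "m > 0"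
  shows "(\<Sum>f\<in>deg_less k. \<chi> (res k m f g)) =
    (\<Sum>c\<in>carrier F - {\<zero>}. \<chi> c ^ m) * (\<Sum>j<k. \<Sum>f\<in>monic j. \<chi> (res j m f g))"
proof (induction k)
  case 0
  have "res 0 m (\<lambda>_. \<zero>) g = res 0 m (\<lambda>_. \<zero> \<otimes> \<zero>) g" by simp
  also have "\<dots> = \<zero>"
    using assms by (subst res_scale) (auto simp: monicD res_closed nat_pow_zero)
  finally show ?case by (simp add: deg_less_0 chi_zero)
next
  case (Suc k)
  let ?N = "{h \<in> deg_less (Suc k). h k \<noteq> \<zero>}"
  have "(\<Sum>f\<in>deg_less (Suc k). \<chi> (res (Suc k) m f g)) =
      (\<Sum>f\<in>deg_less k. \<chi> (res (Suc k) m f g)) + (\<Sum>h\<in>?N. \<chi> (res (Suc k) m h g))"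
    by (subst deg_less_Suc_split, rule sum.union_disjoint) (auto simp: finite_deg_less deg_lessD)
  also have "(\<Sum>f\<in>deg_less k. \<chi> (res (Suc k) m f g)) = (\<Sum>f\<in>deg_less k. \<chi> (res k m f g))"
    by (intro sum.cong refl arg_cong[of _ _ \<chi>] res_drop_degree) (use g in \<open>auto simp: deg_lessD monicD\<close>)
  also have "(\<Sum>h\<in>?N. \<chi> (res (Suc k) m h g)) =
      (\<Sum>(c, f)\<in>(carrier F - {\<zero>}) \<times> monic k. \<chi> (res (Suc k) m (\<lambda>i. c \<otimes> f i) g))"
    by (subst sum.reindex_bij_betw[OF bij_betw_scale_monic, symmetric]) (simp add: case_prod_unfold)
  also have "\<dots> = (\<Sum>(c, f)\<in>(carrier F - {\<zero>}) \<times> monic k. \<chi> c ^ m * \<chi> (res k m f g))"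
  proof (rule sum.cong[OF refl], unfold split_paired_all split_conv)
    fix c f assume "(c, f) \<in> (carrier F - {\<zero>}) \<times> monic k"
    hence c: "c \<in> carrier F" and f: "f \<in> monic k" by auto
    have "res (Suc k) m (\<lambda>i. c \<otimes> f i) g = c [^] m \<otimes> res (Suc k) m f g"
      by (rule res_scale) (use c f g in \<open>auto simp: monicD\<close>)
    also have "res (Suc k) m f g = res k m f g"
      by (rule res_drop_degree) (use f g in \<open>auto simp: monicD\<close>)
    finally show "\<chi> (res (Suc k) m (\<lambda>i. c \<otimes> f i) g) = \<chi> c ^ m * \<chi> (res k m f g)"
      using c f g by (simp add: chi_mult chi_power res_closed monicD)
  qed
  also have "\<dots> = (\<Sum>c\<in>carrier F - {\<zero>}. \<chi> c ^ m) * (\<Sum>f\<in>monic k. \<chi> (res k m f g))"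
    by (simp add: sum_product sum.cartesian_product)
  finally show ?case by (simp add: Suc.IH algebra_simps)
qed

lemma res_add_shift_monic:
  assumes "m \<le> k" "k \<le> n" "a \<in> carrier F" "g \<in> monic m" "f \<in> deg_less k"
  shows "res n m (add_shift (k - m) g a f) g = res n m f g"
  unfolding add_shift_def by (rule res_add_shift) (use assms in \<open>auto simp: monicD deg_lessD\<close>)

text \<open>
  The resultant is unchanged by a division step, so all \<open>q\<close> values of the top coefficient
  give the same sum.
\<close>

lemma sum_deg_less_Suc:
  assumes "m \<le> k" and g: "g \<in> monic m"
  shows "(\<Sum>f\<in>deg_less (Suc k). \<chi> (res (Suc k) m f g)) = of_nat q * (\<Sum>f\<in>deg_less k. \<chi> (res k m f g))"
proof -
  have "(\<Sum>f\<in>deg_less (Suc k). \<chi> (res (Suc k) m f g)) =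
      (\<Sum>a\<in>carrier F. \<Sum>h\<in>{h \<in> deg_less (Suc k). h k = a}. \<chi> (res (Suc k) m h g))"
    by (rule sum.group[symmetric]) (use finite_carrier in \<open>auto simp: finite_deg_less deg_lessD\<close>)
  also have "\<dots> = (\<Sum>a\<in>carrier F. \<Sum>f\<in>deg_less k. \<chi> (res k m f g))"
  proof (rule sum.cong[OF refl])
    fix a assume a: "a \<in> carrier F"
    have "(\<Sum>h\<in>{h \<in> deg_less (Suc k). h k = a}. \<chi> (res (Suc k) m h g)) =
        (\<Sum>f\<in>deg_less k. \<chi> (res (Suc k) m (add_shift (k - m) g a f) g))"
      by (rule sum.reindex_bij_betw[OF bij_betw_add_shift[OF assms a], symmetric])
    also have "\<dots> = (\<Sum>f\<in>deg_less k. \<chi> (res k m f g))"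
    proof (intro sum.cong refl arg_cong[of _ _ \<chi>])
      fix f assume f: "f \<in> deg_less k"
      have "res (Suc k) m (add_shift (k - m) g a f) g = res (Suc k) m f g"
        by (rule res_add_shift_monic) (use assms a f in auto)
      also have "\<dots> = res k m f g"
        by (rule res_drop_degree) (use f g in \<open>auto simp: monicD deg_lessD\<close>)
      finally show "res (Suc k) m (add_shift (k - m) g a f) g = res k m f g" .
    qed
    finally show "(\<Sum>h\<in>{h \<in> deg_less (Suc k). h k = a}. \<chi> (res (Suc k) m h g)) =
        (\<Sum>f\<in>deg_less k. \<chi> (res k m f g))" .
  qed
  finally show ?thesis by (simp add: q_def)
qed

lemma sum_deg_less_ge:
  assumes g: "g \<in> monic m"
  shows "(\<Sum>f\<in>deg_less (m + d). \<chi> (res (m + d) m f g)) = of_nat q ^ d * (\<Sum>f\<in>deg_less m. \<chi> (res m m f g))"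
  by (induction d) (simp_all add: sum_deg_less_Suc[OF _ g])

text \<open>
  Division of \<open>f\<close> by \<open>g\<close>: each remainder arises from \<open>q\<^bsup>n-m\<^esup>\<close> monic polynomials of degree \<open>n\<close>.
\<close>

lemma sum_monic_ge:
  assumes "m \<le> n" "m > 0" and g: "g \<in> monic m"
  shows "(\<Sum>f\<in>monic n. \<chi> (res n m f g)) = of_nat q ^ (n - m) *
    ((\<Sum>c\<in>carrier F - {\<zero>}. \<chi> c ^ m) * (\<Sum>j<m. \<Sum>f\<in>monic j. \<chi> (res j m f g)))"
proof -
  have "(\<Sum>f\<in>monic n. \<chi> (res n m f g)) = (\<Sum>f\<in>deg_less n. \<chi> (res n m (add_shift (n - m) g \<one> f) g))"
    using sum.reindex_bij_betw[OF bij_betw_add_shift[OF assms(1) g one_closed], of "\<lambda>h. \<chi> (res n m h g)"]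
    by (simp add: monic_def)
  also have "\<dots> = (\<Sum>f\<in>deg_less n. \<chi> (res n m f g))"
    using assms by (intro sum.cong refl) (simp add: res_add_shift_monic)
  also have "\<dots> = of_nat q ^ (n - m) * (\<Sum>f\<in>deg_less m. \<chi> (res m m f g))"
    using sum_deg_less_ge[OF g, of "n - m"] assms(1) by simp
  finally show ?thesis by (simp only: sum_deg_less_eq_sum_monic[OF g assms(2)])
qed

lemma res_sum_rec:
  assumes "m \<le> n" "m > 0"
  shows "res_sum n m = of_nat q ^ (n - m) * (if e dvd m then of_nat q - 1 else 0) * (\<Sum>j<m. res_sum j m)"
proof -
  have "res_sum n m = (\<Sum>g\<in>monic m. (of_nat q ^ (n - m) * (if e dvd m then of_nat q - 1 else 0)) *
      (\<Sum>j<m. \<Sum>f\<in>monic j. \<chi> (res j m f g)))"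
    unfolding res_sum_def
    by (intro sum.cong refl) (simp only: sum_monic_ge[OF assms] sum_chi_power mult.assoc)
  also have "\<dots> = of_nat q ^ (n - m) * (if e dvd m then of_nat q - 1 else 0) *
      (\<Sum>g\<in>monic m. \<Sum>j<m. \<Sum>f\<in>monic j. \<chi> (res j m f g))"
    by (rule sum_distrib_left[symmetric])
  also have "(\<Sum>g\<in>monic m. \<Sum>j<m. \<Sum>f\<in>monic j. \<chi> (res j m f g)) = (\<Sum>j<m. res_sum j m)"
    unfolding res_sum_def by (rule sum.swap)
  finally show ?thesis .
qed

text \<open>
  As \<open>\<chi>\<^sup>m = 1\<close>, the sign \<open>(-1)\<^bsup>j m\<^esup>\<close> is mapped to \<open>1\<close>.
\<close>

lemma res_sum_swap:
  assumes "e dvd m"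
  shows "res_sum j m = res_sum m j"
proof -
  have "\<chi> (\<ominus> \<one>) ^ m = 1" using assms chi_order[of m] by simp
  hence sgn: "\<chi> ((\<ominus> \<one>) [^] (j * m)) = 1"
    by (simp add: chi_power mult.commute[of j] power_mult)
  have "\<chi> (res j m f g) = \<chi> (res m j g f)" if "f \<in> monic j" "g \<in> monic m" for f g
    using that sgn by (subst res_swap) (auto simp: monicD chi_mult res_closed)
  hence "res_sum j m = (\<Sum>g\<in>monic m. \<Sum>f\<in>monic j. \<chi> (res m j g f))"
    unfolding res_sum_def by (intro sum.cong) auto
  also have "\<dots> = res_sum m j" unfolding res_sum_def by (rule sum.swap)
  finally show ?thesis .
qed

lemma res_sum_0_right: "res_sum n 0 = of_nat q ^ n"
proof -
  have "res_sum n 0 = (\<Sum>f\<in>monic n. 1)"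
    by (simp add: res_sum_def monic_0 res_one_right monicD chi_one)
  thus ?thesis by (simp add: card_monic)
qed

text \<open>
  Solution of the recursion by induction on \<open>m\<close>.  With \<open>m = e i\<close>, only the degrees
  \<open>j = e k\<close> with \<open>k < i\<close> contribute, and the sum over \<open>k\<close> telescopes because
  \<open>(q - 1) q\<^bsup>k-1\<^esup> = q\<^sup>k - q\<^bsup>k-1\<^esup>\<close>.
\<close>

theorem res_sum_eq:
  assumes "m \<le> n" "m > 0"
  shows "res_sum n m = (if e dvd m then of_nat q ^ n * (of_nat q - 1) * of_nat q ^ (m div e - 1) else 0)"
  using assms
proof (induction m arbitrary: n rule: less_induct)
  case (less m)
  show ?case
  proof (cases "e dvd m")
    case False
    thus ?thesis using less.prems by (simp add: res_sum_rec)
  next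
    case True
    then obtain i where i: "m = e * i" by blast
    with less.prems have "i > 0" by simp
    \<comment> \<open>the value of \<open>T(m, e k)\<close>; the term \<open>k = 0\<close> counts the monic polynomials of degree \<open>m\<close>\<close>
    let ?h = "\<lambda>k. of_nat q ^ m * (if k = 0 then 1 else (of_nat q - 1) * of_nat q ^ (k - 1)) :: complex"
    have "(\<Sum>j<m. res_sum j m) = (\<Sum>j<m. res_sum m j)"
      by (intro sum.cong refl res_sum_swap True)
    also have "\<dots> = (\<Sum>j<m. if e dvd j then ?h (j div e) else 0)"
    proof (intro sum.cong refl)
      fix j assume "j \<in> {..<m}"
      thus "res_sum m j = (if e dvd j then ?h (j div e) else 0)"
        using less.IH[of j m] e_pos
        by (cases "j = 0") (auto simp: res_sum_0_right dvd_div_eq_0_iff)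
    qed
    also have "\<dots> = (\<Sum>k<i. ?h k)"
      unfolding i by (rule sum_multiples[OF e_pos])
    also have "\<dots> = of_nat q ^ m * of_nat q ^ (i - 1)"
      using \<open>i > 0\<close>
    proof (induction i rule: nat_induct_non_zero)
      case (Suc l)
      thus ?case by (cases l) (simp_all add: algebra_simps)
    qed simp
    finally have "(\<Sum>j<m. res_sum j m) = of_nat q ^ m * of_nat q ^ (i - 1)" .
    moreover have "m div e = i" using e_pos i by simp
    moreover have "(of_nat q :: complex) ^ n = of_nat q ^ (n - m) * of_nat q ^ m"
      using less.prems by (simp flip: power_add)
    ultimately show ?thesis
      unfolding res_sum_rec[OF less.prems] using True by (simp add: mult_ac)
  qed
qed

end

section \<open>The characters of a finite field\<close>

lemma cis_power_eq_1_iff: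
  assumes "M > 0"
  shows "cis (2 * pi / real M) ^ j = 1 \<longleftrightarrow> M dvd j"
proof -
  let ?z = "\<lambda>k. cis (2 * pi * real k / real M)"
  have pow: "cis (2 * pi / real M) ^ k = ?z k" for k
    by (simp add: Complex.DeMoivre mult_ac)
  have M: "cis (2 * pi / real M) ^ M = 1"
    using assms by (simp add: Complex.DeMoivre)
  have "cis (2 * pi / real M) ^ j = cis (2 * pi / real M) ^ (M * (j div M) + j mod M)" by simp
  also have "\<dots> = ?z (j mod M)"
    unfolding power_add power_mult M by (simp add: pow)
  finally have "cis (2 * pi / real M) ^ j = 1 \<longleftrightarrow> ?z (j mod M) = ?z 0" by simp
  also have "\<dots> \<longleftrightarrow> j mod M = 0"
    using bij_betw_roots_unity[OF assms] assms
    by (intro inj_on_eq_iff[of ?z "{..<M}"]) (auto simp: bij_betw_def)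
  finally show ?thesis by (simp add: dvd_eq_mod_eq_0)
qed

lemma dvd_mult_iff_div_gcd_dvd:
  fixes M k m :: nat
  assumes "M > 0"
  shows "M dvd k * m \<longleftrightarrow> M div gcd k M dvd m"
proof -
  define g where "g = gcd k M"
  have "g > 0" using assms by (simp add: g_def)
  obtain M' k' where *: "M = g * M'" "k = g * k'" "coprime k' M'"
    using gcd_coprime_exists[of k M] \<open>g > 0\<close> unfolding g_def by (metis mult.commute not_gr_zero)
  have "M dvd k * m \<longleftrightarrow> M' dvd k' * m" using \<open>g > 0\<close> unfolding * by (simp add: mult.assoc)
  also have "\<dots> \<longleftrightarrow> M' dvd m"
    using *(3) by (simp add: coprime_dvd_mult_right_iff coprime_commute)
  finally show ?thesis using \<open>g > 0\<close> unfolding g_def[symmetric] by (simp add: *(1))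
qed

context finite_field_carrier
begin

lemma q_gt_1: "q > 1"
proof -
  have "card {\<zero>, \<one>} \<le> q" unfolding q_def by (rule card_mono[OF finite_carrier]) auto
  thus ?thesis by simp
qed

text \<open>
  The powers of \<^term>\<open>gen\<close> exhaust the \<open>q - 1\<close> nonzero elements, so its order is \<open>q - 1\<close>.
\<close>

lemma gen_pow_eq_one_iff: "gen [^] (t::nat) = \<one> \<longleftrightarrow> (q - 1) dvd t"
proof -
  interpret G: group "Multiplicative_Group.mult_of F" rewrites
      "([^]\<^bsub>Multiplicative_Group.mult_of F\<^esub>) = (([^]) :: _ \<Rightarrow> nat \<Rightarrow> _)" and "\<one>\<^bsub>Multiplicative_Group.mult_of F\<^esub> = \<one>"
    by (rule field_mult_group) (simp_all add: fun_eq_iff nat_pow_def)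
  have fin: "finite (carrier (Multiplicative_Group.mult_of F))" by (rule finite_mult_of[OF finite_carrier])
  have g: "gen \<in> carrier (Multiplicative_Group.mult_of F)" using gen(1) by simp
  have "carrier F - {\<zero>} = {gen [^] x | x. x \<in> (UNIV :: nat set)}"
    using gen(2) by (auto simp: full_SetCompr_eq)
  also have "\<dots> = (\<lambda>x. gen [^] x) ` {0..G.ord gen - 1}"
    unfolding G.ord_elems[OF fin g] by auto
  finally have "card (carrier F - {\<zero>}) = card {0..G.ord gen - 1}"
    using card_image[OF G.ord_inj[OF g]] by simp
  hence "G.ord gen = q - 1"
    using G.ord_ge_1[OF fin g] finite_carrier by (simp add: q_def card_Diff_singleton)
  thus ?thesis using G.pow_eq_id[OF g, of t] by simp
qed

definition dlog :: "'a \<Rightarrow> nat" where "dlog x = (SOME t. gen [^] t = x)"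

definition zeta :: complex where "zeta = cis (2 * pi / real (q - 1))"

lemma zeta_power_eq_1_iff: "zeta ^ j = 1 \<longleftrightarrow> (q - 1) dvd j"
  unfolding zeta_def by (rule cis_power_eq_1_iff) (use q_gt_1 in simp)

text \<open>
  The character with \<open>gen \<mapsto> zeta\<^sup>k\<close>.
\<close>

definition chi :: "nat \<Rightarrow> 'a \<Rightarrow> complex" where
  "chi k x = (if x = \<zero> then 0 else zeta ^ (k * dlog x))"

lemma zeta_power_eq:
  assumes "gen [^] (s::nat) = gen [^] (t::nat)"
  shows "zeta ^ s = zeta ^ t"
proof -
  have le: "zeta ^ s = zeta ^ t" if "gen [^] s = gen [^] t" "s \<le> t" for s t :: nat
  proof -
    have "gen [^] s \<otimes> gen [^] (t - s) = gen [^] t"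
      using that(2) gen(1) by (simp add: nat_pow_mult)
    hence "gen [^] s \<otimes> gen [^] (t - s) = gen [^] s \<otimes> \<one>"
      using that(1) gen(1) by simp
    moreover have "gen [^] s \<noteq> \<zero>" using gen(2) by auto
    ultimately have "gen [^] (t - s) = \<one>"
      using gen(1) m_lcancel[of "gen [^] s" "gen [^] (t - s)" \<one>] by simp
    hence "zeta ^ (t - s) = 1" by (simp only: gen_pow_eq_one_iff zeta_power_eq_1_iff)
    moreover have "zeta ^ t = zeta ^ s * zeta ^ (t - s)"
      using that by (simp flip: power_add)
    ultimately show ?thesis by simp
  qed
  show ?thesis
    using le[OF assms] le[OF assms[symmetric]] by (metis nat_le_linear)
qed

lemma chi_gen_power: "chi k (gen [^] (t::nat)) = zeta ^ (k * t)"
proof -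
  have "gen [^] dlog (gen [^] t) = gen [^] t"
    unfolding dlog_def by (rule someI) simp
  from zeta_power_eq[OF this] have "zeta ^ (k * dlog (gen [^] t)) = zeta ^ (k * t)"
    by (simp only: mult.commute[of k] power_mult)
  moreover have "gen [^] t \<noteq> \<zero>" using gen(2) by auto
  ultimately show ?thesis by (simp only: chi_def if_False)
qed

lemma nonzero_is_gen_power:
  assumes "x \<in> carrier F" "x \<noteq> \<zero>"
  obtains t :: nat where "x = gen [^] t"
  using assms gen(2) by blast

text \<open>
  The \<open>m\<close>-th power of the character is trivial iff it is so at the generator, that is, iff
  \<open>q - 1\<close> divides \<open>k m\<close>.
\<close>

lemma finite_field_character_chi:
  assumes "k > 0"
  shows "finite_field_character F (chi k) ((q - 1) div gcd k (q - 1))"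
proof unfold_locales
  show "chi k (x \<otimes> y) = chi k x * chi k y" if xy: "x \<in> carrier F" "y \<in> carrier F" for x y
  proof (cases "x = \<zero> \<or> y = \<zero>")
    case False
    obtain s :: nat where s: "x = gen [^] s"
      using nonzero_is_gen_power[of x] xy False by blast
    obtain t :: nat where t: "y = gen [^] t"
      using nonzero_is_gen_power[of y] xy False by blast
    note st = s t
    have "x \<otimes> y = gen [^] (s + t)" unfolding st using gen(1) by (simp add: nat_pow_mult)
    thus ?thesis by (simp add: st chi_gen_power power_add distrib_left)
  qed (use xy in \<open>auto simp: chi_def\<close>)
  show "chi k \<zero> = 0" by (simp add: chi_def)
  show "chi k \<one> = 1" using chi_gen_power[of k 0] by simp
  show "(q - 1) div gcd k (q - 1) > 0" using q_gt_1
    by (simp add: div_greater_zero_iff gcd_le2_nat)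
  show "(\<forall>c\<in>carrier F - {\<zero>}. chi k c ^ m = 1) \<longleftrightarrow> (q - 1) div gcd k (q - 1) dvd m" for m
  proof -
    have "(\<forall>c\<in>carrier F - {\<zero>}. chi k c ^ m = 1) \<longleftrightarrow> (\<forall>t::nat. (q - 1) dvd t * (k * m))"
      unfolding gen(2) by (simp add: chi_gen_power zeta_power_eq_1_iff mult_ac flip: power_mult)
    also have "\<dots> \<longleftrightarrow> (q - 1) dvd k * m"
      by (metis dvd_mult mult_1)
    also have "\<dots> \<longleftrightarrow> (q - 1) div gcd k (q - 1) dvd m"
      by (rule dvd_mult_iff_div_gcd_dvd) (use q_gt_1 in simp)
    finally show ?thesis .
  qed
qed

text \<open>
  Orthogonality.  The index range \<open>{0<..q - 1}\<close>, a full set of residues modulo \<open>q - 1\<close> with the trivial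
  character at \<open>k = q - 1\<close>, is chosen to match the gcd count for the totient function.
\<close>

lemma sum_chi:
  assumes "x \<in> carrier F"
  shows "(\<Sum>k\<in>{0<..q - 1}. chi k x) = (if x = \<one> then of_nat (q - 1) else 0)"
proof (cases "x = \<zero>")
  case False
  then obtain t :: nat where t: "x = gen [^] t" using assms nonzero_is_gen_power by blast
  let ?w = "zeta ^ t"
  have "(\<Sum>k\<in>{0<..q - 1}. chi k x) = (\<Sum>k\<in>{0<..q - 1}. ?w ^ k)"
    by (simp add: t chi_gen_power mult.commute flip: power_mult)
  also have "\<dots> = (\<Sum>k\<in>Suc ` {..<q - 1}. ?w ^ k)"
    by (rule sum.cong) (auto simp: image_iff gr0_conv_Suc Suc_le_eq)
  also have "\<dots> = ?w * (\<Sum>k<q - 1. ?w ^ k)"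
    by (simp add: sum.reindex sum_distrib_left)
  finally have eq: "(\<Sum>k\<in>{0<..q - 1}. chi k x) = ?w * (\<Sum>k<q - 1. ?w ^ k)" .
  show ?thesis
  proof (cases "x = \<one>")
    case True
    hence "?w = 1" by (simp add: t gen_pow_eq_one_iff zeta_power_eq_1_iff)
    thus ?thesis using eq True by simp
  next
    case False
    hence "?w \<noteq> 1" by (simp add: t gen_pow_eq_one_iff zeta_power_eq_1_iff)
    moreover have "?w ^ (q - 1) = 1"
      by (simp add: zeta_power_eq_1_iff flip: power_mult)
    ultimately show ?thesis using eq False by (simp add: sum_gp_strict)
  qed
qed (simp add: chi_def)

lemma card_res_one_by_characters:
  assumes "n > 0"
  shows "card {(f, g) \<in> monic n \<times> monic n. res n n f g = \<one>} =
    (\<Sum>k\<in>{0<..q - 1}. let e = (q - 1) div gcd k (q - 1) in if e dvd n then q ^ (n - 1 + n div e) else 0)"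
    (is "card ?P = (\<Sum>k\<in>?K. ?h k)")
proof -
  have "of_nat (q - 1) * (of_nat (card ?P) :: complex) =
      (\<Sum>p\<in>monic n \<times> monic n. if res n n (fst p) (snd p) = \<one> then of_nat (q - 1) else 0)"
    by (simp add: sum.If_cases finite_monic Int_def case_prod_unfold mem_Times_iff)
  also have "\<dots> = (\<Sum>p\<in>monic n \<times> monic n. \<Sum>k\<in>?K. chi k (res n n (fst p) (snd p)))"
    by (rule sum.cong[OF refl], subst sum_chi) (auto simp: res_closed monicD)
  also have "\<dots> = (\<Sum>k\<in>?K. \<Sum>p\<in>monic n \<times> monic n. chi k (res n n (fst p) (snd p)))"
    by (rule sum.swap)
  also have "\<dots> = (\<Sum>k\<in>?K. of_nat (q - 1) * of_nat (?h k))"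
  proof (rule sum.cong[OF refl])
    fix k assume "k \<in> ?K"
    then interpret finite_field_character F "chi k" "(q - 1) div gcd k (q - 1)"
      by (intro finite_field_character_chi) simp
    let ?e = "(q - 1) div gcd k (q - 1)"
    have "(\<Sum>p\<in>monic n \<times> monic n. chi k (res n n (fst p) (snd p))) = res_sum n n"
      unfolding res_sum_def
      by (subst sum.swap) (simp add: sum.cartesian_product case_prod_unfold)
    also have "\<dots> = of_nat (q - 1) * of_nat (?h k)"
    proof (cases "?e dvd n")
      case True
      hence "n div ?e > 0" using assms e_pos by (simp add: dvd_imp_le div_greater_zero_iff)
      hence "n - 1 + n div ?e = n + (n div ?e - 1)" using assms by simp
      thus ?thesis
        unfolding res_sum_eq[OF order_refl assms] Let_def using True q_gt_1
        by (simp add: power_add of_nat_diff)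
    next
      case False
      thus ?thesis unfolding res_sum_eq[OF order_refl assms] Let_def by simp
    qed
    finally show "(\<Sum>p\<in>monic n \<times> monic n. chi k (res n n (fst p) (snd p))) =
        of_nat (q - 1) * of_nat (?h k)" .
  qed
  also have "\<dots> = of_nat (q - 1) * of_nat (\<Sum>k\<in>?K. ?h k)"
    by (simp only: of_nat_sum sum_distrib_left)
  finally have "(of_nat (card ?P) :: complex) = of_nat (\<Sum>k\<in>?K. ?h k)"
    using q_gt_1 by (subst (asm) mult_cancel_left) simp
  thus ?thesis by (simp only: of_nat_eq_iff)
qed

end

section \<open>The number of pairs with resultant one\<close>

lemma bij_betw_Collect_preimage:
  assumes "bij_betw h A B"
  shows "bij_betw h {x \<in> A. P (h x)} {y \<in> B. P y}"
  using assms by (auto simp: bij_betw_def inj_on_def)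

text \<open>
  Exactly \<open>\<phi>(e)\<close> of the numbers \<open>1, \<dots>, M\<close> satisfy \<open>M / gcd(k, M) = e\<close>, for every divisor \<open>e\<close> of \<open>M\<close>.
\<close>

lemma sum_over_gcd:
  fixes h :: "nat \<Rightarrow> nat"
  assumes "M > 0"
  shows "(\<Sum>k\<in>{0<..M}. h (M div gcd k M)) = (\<Sum>e | e dvd M. totient e * h e)"
proof -
  have fin: "finite {d. d dvd M}" using assms by simp
  have "(\<Sum>k\<in>{0<..M}. h (M div gcd k M)) =
      (\<Sum>d | d dvd M. \<Sum>k\<in>{k \<in> {0<..M}. gcd k M = d}. h (M div gcd k M))"
    by (rule sum.group[symmetric]) (use fin in auto)
  also have "\<dots> = (\<Sum>d | d dvd M. totient (M div d) * h (M div d))"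
    by (rule sum.cong) (simp_all add: card_gcd_eq_totient[OF assms, symmetric])
  also have "\<dots> = (\<Sum>e | e dvd M. totient e * h e)"
    by (rule sum.reindex_bij_witness[where i = "\<lambda>e. M div e" and j = "\<lambda>d. M div d"])
       (use assms in \<open>auto elim!: dvdE\<close>)
  finally show ?thesis .
qed

text \<open>
  The substitution is \<open>a = n/e\<close>.
\<close>

lemma sum_common_divisors_eq_sum_F_set:
  assumes "n > 0" "q > 1"
  shows "(\<Sum>e | e dvd q - 1. totient e * (if e dvd n then q ^ (n - 1 + n div e) else 0)) =
    (\<Sum>a\<in>F_set q n. totient (n div a) * q ^ (n - 1 + a))"
proof -
  have cong: "[q = 1] (mod d) \<longleftrightarrow> d dvd q - 1" for d
    using assms by (simp add: cong_altdef_nat)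
  have "(\<Sum>e | e dvd q - 1. totient e * (if e dvd n then q ^ (n - 1 + n div e) else 0)) =
      (\<Sum>e | e dvd q - 1 \<and> e dvd n. totient e * q ^ (n - 1 + n div e))"
    using assms by (intro sum.mono_neutral_cong_right) auto
  also have "\<dots> = (\<Sum>a\<in>F_set q n. totient (n div a) * q ^ (n - 1 + a))"
    by (rule sum.reindex_bij_witness[where i = "\<lambda>a. n div a" and j = "\<lambda>e. n div e"])
       (use assms in \<open>auto simp: F_set_def cong[unfolded One_nat_def] elim!: dvdE\<close>)
  finally show ?thesis .
qed

context finite_field_carrier
begin

lemma monic_resultant_eq_res: "monic_resultant F n f g = res n n (coeff f) (coeff g)"
proof -
  have "resultant_matrix F n f g = sylvester_entry n (coeff f) (coeff g) \<zero>"
    by (simp add: fun_eq_iff resultant_matrix_def sylvester_entry_def Let_def)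
  thus ?thesis by (simp add: monic_resultant_def res_def mult_2)
qed

lemma bij_betw_coeff_monic: "bij_betw coeff (monic_polys F n) (monic n)"
proof (rule bij_betwI')
  have len: "p \<noteq> [] \<and> length p = Suc n \<and> set p \<subseteq> carrier F \<and> hd p = \<one>" if "p \<in> monic_polys F n" for p
    using that by (cases p) (auto simp: monic_polys_def univ_poly_def polynomial_def)
  show "coeff p = coeff p' \<longleftrightarrow> p = p'" if "p \<in> monic_polys F n" "p' \<in> monic_polys F n" for p p'
    using coeff_iff_length_cond[of p p'] len that by auto
  show "coeff p \<in> monic n" if "p \<in> monic_polys F n" for p
    using len[OF that] lead_coeff_simp[of p] coeff_length[of p]
    by (auto simp: monic_def deg_less_def)
  show "\<exists>p\<in>monic_polys F n. h = coeff p" if h: "h \<in> monic n" for h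
  proof (rule bexI)
    let ?p = "map h (rev [0..<Suc n])"
    show "h = coeff ?p"
    proof
      fix i show "h i = coeff ?p i"
      proof (cases "i < Suc n")
        case True
        hence "coeff ?p i = ?p ! (n - i)" by (subst coeff_nth) simp_all
        also have "\<dots> = h i" using True by (simp add: rev_nth del: upt_Suc)
        finally show ?thesis ..
      next
        case False
        hence "coeff ?p i = \<zero>" by (intro coeff_length) simp
        thus ?thesis using False h by (simp add: monicD)
      qed
    qed
    show "?p \<in> monic_polys F n"
      using h by (auto simp: monic_polys_def univ_poly_def polynomial_def monicD)
  qed
qed

text \<open>
  The mean of \<open>T(n, n)\<close> over all characters, sorted by their order \<open>n/a\<close>.
\<close>

theorem card_resultant_one_pairs:
  assumes "n > 0"
  shows "card (resultant_one_pairs F n) = (\<Sum>a\<in>F_set q n. totient (n div a) * q ^ (n - 1 + a))"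
proof -
  let ?P = "{(f, g) \<in> monic n \<times> monic n. res n n f g = \<one>}"
  have "bij_betw (map_prod coeff coeff) (monic_polys F n \<times> monic_polys F n) (monic n \<times> monic n)"
    by (intro bij_betw_map_prod bij_betw_coeff_monic)
  note bij = bij_betw_Collect_preimage[OF this, of "\<lambda>(f, g). res n n f g = \<one>"]
  have "resultant_one_pairs F n = {p \<in> monic_polys F n \<times> monic_polys F n.
      case map_prod coeff coeff p of (f, g) \<Rightarrow> res n n f g = \<one>}"
    by (auto simp: resultant_one_pairs_def monic_resultant_eq_res)
  moreover have "?P = {p \<in> monic n \<times> monic n. case p of (f, g) \<Rightarrow> res n n f g = \<one>}" by auto
  ultimately have "bij_betw (map_prod coeff coeff) (resultant_one_pairs F n) ?P" using bij by simp
  hence "card (resultant_one_pairs F n) = card ?P" by (rule bij_betw_same_card)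
  also have "\<dots> = (\<Sum>k\<in>{0<..q - 1}. let e = (q - 1) div gcd k (q - 1) in
      if e dvd n then q ^ (n - 1 + n div e) else 0)"
    by (rule card_res_one_by_characters[OF assms])
  also have "\<dots> = (\<Sum>e | e dvd q - 1. totient e * (if e dvd n then q ^ (n - 1 + n div e) else 0))"
    unfolding Let_def by (rule sum_over_gcd) (use q_gt_1 in simp)
  also have "\<dots> = (\<Sum>a\<in>F_set q n. totient (n div a) * q ^ (n - 1 + a))"
    by (rule sum_common_divisors_eq_sum_F_set[OF assms q_gt_1])
  finally show ?thesis .
qed

end

lemma totient_ext_of_nat: "totient_ext (of_nat m) = totient m"
  by (simp add: totient_ext_def)

lemma totient_ext_quotient:
  assumes "a > 0"
  shows "totient_ext (of_nat n / of_nat a) = (if a dvd n then totient (n div a) else 0)"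
proof (cases "a dvd n")
  case True
  hence "(of_nat n / of_nat a :: rat) = of_nat (n div a)" using assms by (auto elim!: dvdE)
  thus ?thesis using True by (simp only: totient_ext_of_nat if_True)
next
  case False
  have "(of_nat n / of_nat a :: rat) \<notin> \<nat>"
  proof
    assume "(of_nat n / of_nat a :: rat) \<in> \<nat>"
    then obtain m where "(of_nat n / of_nat a :: rat) = of_nat m" by (auto elim: Nats_cases)
    hence "(of_nat n :: rat) = of_nat (m * a)" using assms by (simp add: field_simps)
    hence "n = m * a" by (simp only: of_nat_eq_iff)
    thus False using False by simp
  qed
  thus ?thesis using False by (simp add: totient_ext_def)
qed

lemma rat_power_shift:
  assumes "q > 0" "n > 0"
  shows "(of_nat q :: rat) ^ (2 * n - 1) * of_nat q powi (int a - int n) = of_nat (q ^ (n - 1 + a))"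
proof -
  have "(of_nat q :: rat) ^ (2 * n - 1) * of_nat q powi (int a - int n) =
      of_nat q powi (int (2 * n - 1) + (int a - int n))"
    using assms by (subst power_int_add) (simp_all only: power_int_of_nat of_nat_eq_0_iff, simp_all)
  also have "int (2 * n - 1) + (int a - int n) = int (n - 1 + a)"
    using assms by simp
  finally show ?thesis by (simp only: power_int_of_nat of_nat_power)
qed

lemma F_set_eq:
  assumes "n > 0"
  shows "F_set q n = {a. a dvd n \<and> [q = 1] (mod (n div a))}"
  using assms by (auto simp: F_set_def dvd_pos_nat)

theorem corollary1p4:
  fixes n :: nat
  assumes "n \<ge> 1"
  shows "\<exists>S :: nat set. finite S \<and>
    (\<forall>(p :: nat) (k :: nat) (q :: nat) (F :: 'a ring).
       prime p \<and> p \<notin> S \<and> \<not> p dvd n \<and> k \<ge> 1 \<and> q = p ^ k \<and>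
       field F \<and> finite (carrier F) \<and> card (carrier F) = q \<longrightarrow>
         (of_nat (card (resultant_one_pairs F n)) :: rat) =
           of_nat q ^ (2 * n - 1) *
             (\<Sum>a \<in> F_set q n. of_nat (totient_ext (of_nat n / of_nat a)) *
                of_nat q powi (int a - int n)) \<and>
         (gcd (q - 1) n = 1 \<longrightarrow> card (resultant_one_pairs F n) = q ^ (2 * n - 1)) \<and>
         ([q = 1] (mod n) \<longrightarrow>
           (of_nat (card (resultant_one_pairs F n)) :: rat) =
             of_nat q ^ (2 * n - 1) *
               (\<Sum>i = 0..n - 1. of_nat (totient_ext (of_nat n / of_nat (n - i))) *
                  of_nat q powi (- int i))) \<and>
         (prime n \<and> [q = 1] (mod n) \<longrightarrow>
           card (resultant_one_pairs F n) = q ^ (2 * n - 1) + (n - 1) * q ^ n))"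
proof (intro exI[of _ "{}"] conjI allI impI finite.emptyI; elim conjE)
  fix p k q :: nat and F :: "'a ring"
  assume F: "field F" "finite (carrier F)" "card (carrier F) = q"
  interpret finite_field_carrier F
    by (intro finite_field_carrier.intro finite_field_carrier_axioms.intro F)
  have n: "n > 0" using assms by simp
  have q: "q > 1" using q_gt_1 F(3) by (simp add: q_def)
  have count: "card (resultant_one_pairs F n) = (\<Sum>a\<in>F_set q n. totient (n div a) * q ^ (n - 1 + a))"
    using card_resultant_one_pairs[OF n] F(3) by (simp add: q_def)
  have "(of_nat (card (resultant_one_pairs F n)) :: rat) =
      (\<Sum>a\<in>F_set q n. of_nat (totient_ext (of_nat n / of_nat a)) *
        (of_nat q ^ (2 * n - 1) * of_nat q powi (int a - int n)))"
    unfolding count of_nat_sum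
    by (rule sum.cong[OF refl], subst rat_power_shift)
       (use q n in \<open>auto simp: F_set_def totient_ext_quotient\<close>)
  also have "\<dots> = of_nat q ^ (2 * n - 1) *
      (\<Sum>a \<in> F_set q n. of_nat (totient_ext (of_nat n / of_nat a)) * of_nat q powi (int a - int n))"
    by (simp add: sum_distrib_left mult_ac)
  finally show general: "(of_nat (card (resultant_one_pairs F n)) :: rat) = of_nat q ^ (2 * n - 1) *
      (\<Sum>a \<in> F_set q n. of_nat (totient_ext (of_nat n / of_nat a)) * of_nat q powi (int a - int n))" .
  show "card (resultant_one_pairs F n) = q ^ (2 * n - 1)" if "gcd (q - 1) n = 1"
  proof -
    have "F_set q n = {n}"
    proof (rule Set.set_eqI)
      fix a
      have "a = n" if a: "a dvd n" "[q = 1] (mod (n div a))"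
      proof -
        have "n div a dvd q - 1" using a(2) q by (simp add: cong_altdef_nat)
        moreover have "n div a dvd n" using a(1) by (metis dvd_div_mult_self dvd_triv_left)
        ultimately have "n div a dvd gcd (q - 1) n" by (rule gcd_greatest)
        hence "n div a dvd 1" by (simp only: \<open>gcd (q - 1) n = 1\<close>)
        hence "n div a = 1" by simp
        thus "a = n" using a(1) by (metis dvd_div_mult_self mult_1)
      qed
      thus "a \<in> F_set q n \<longleftrightarrow> a \<in> {n}" using n by (auto simp: F_set_eq)
    qed
    thus ?thesis using n by (simp add: count mult_2)
  qed
  show "(of_nat (card (resultant_one_pairs F n)) :: rat) = of_nat q ^ (2 * n - 1) *
      (\<Sum>i = 0..n - 1. of_nat (totient_ext (of_nat n / of_nat (n - i))) * of_nat q powi (- int i))"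
    if "[q = 1] (mod n)"
  proof -
    \<comment> \<open>all divisors qualify, and the terms with \<open>n - i\<close> not dividing \<open>n\<close> vanish by the extension of \<open>\<phi>\<close>\<close>
    have F_set: "F_set q n = {a. a dvd n}"
      using that n by (auto simp: F_set_eq intro: cong_dvd_modulus_nat)
        (metis cong_dvd_modulus_nat dvd_div_mult_self dvd_triv_left)
    have "(\<Sum>i = 0..n - 1. of_nat (totient_ext (of_nat n / of_nat (n - i))) * of_nat q powi (- int i) :: rat) =
        (\<Sum>a\<in>{1..n}. of_nat (totient_ext (of_nat n / of_nat a)) * of_nat q powi (int a - int n))"
      by (rule sum.reindex_bij_witness[where i = "\<lambda>a. n - a" and j = "\<lambda>i. n - i"]) (use n in auto)
    also have "\<dots> = (\<Sum>a\<in>F_set q n. of_nat (totient_ext (of_nat n / of_nat a)) * of_nat q powi (int a - int n))"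
      unfolding F_set
    proof (rule sum.mono_neutral_right)
      show "{a. a dvd n} \<subseteq> {1..n}"
        using n by (auto simp: Suc_le_eq dvd_pos_nat dvd_imp_le)
    qed (auto simp: totient_ext_quotient)
    finally show ?thesis by (simp only: general)
  qed
  show "card (resultant_one_pairs F n) = q ^ (2 * n - 1) + (n - 1) * q ^ n"
    if "prime n" "[q = 1] (mod n)"
  proof -
    have "F_set q n = {1, n}"
      using that n by (auto simp: F_set_eq prime_nat_iff)
    moreover have "n \<noteq> 1" using that by auto
    ultimately show ?thesis
      using n that by (simp add: count mult_2 totient_prime)
  qed
qed

end
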